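(* Let $(E,\mathcal E,\mu)$ be a measure space and let $G\colon E\times E\to[0,\infty]$ be $\mathcal E\otimes\mathcal E$-measurable. If both $\mathcal F_{ui}(G)$ and $\mathcal F_{co}(G)$ contain strictly positive functions, then $\mathcal F_{co}(G)=\mathcal F_{ui}(G)$.
   Context: $\mathcal E^+$ is the set of all $\mathcal E$-measurable functions $f\colon E\to[0,\infty]$. $\mathcal E_b$ is the space of all bounded $\mathcal E$-measurable functions $f\colon E\to\mathbb R$, equipped with the sup-norm $\|\cdot\|_\infty$. The convention $0\cdot\infty=0$ is used. A function $q$ on $E$ is strictly positive if $q(x)>0$ for every $x\in E$. For a measurable function $f$ on $E$ (for $f\in\mathcal E^+$, or whenever the integrals exist), $Gf(x):=\int G(x,y)f(y)\,d\mu(y)$, $x\in E$. For $q\in\mathcal E^+$ with $Gq$ bounded, $K_q$ denotes the map $f\mapsto G(fq)$ on $\mathcal E_b$, i.e. $K_qf(x)=\int G(x,y)f(y)q(y)\,d\mu(y)$. $\mathcal F_{co}(G)$ is the set of all $q\in\mathcal E^+$ such that $Gq$ is bounded and $K_q$ is a compact operator on $\mathcal E_b$ (in particular it maps $\mathcal E_b$ into $\mathcal E_b$). A subset $\mathcal F$ of $\mathcal E^+$ is called uniformly integrable if for every $\varepsilon>0$ there exists a $\mu$-integrable $g\in\mathcal E^+$ such that $\int_{\{f\ge g\}}f\,d\mu\le\varepsilon$ for every $f\in\mathcal F$. $\mathcal F_{ui}(G)$ is the set of all $q\in\mathcal E^+$ such that the family $\{G(x,\cdot)q\colon x\in E\}$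 is uniformly integrable. *)

theory Defs
  imports "HOL-Analysis.Analysis"
begin

text \<open>
  The measurable space is \<open>E = space M\<close> with sigma-algebra \<open>sets M\<close>, and \<open>\<mu>\<close> is the measure of
  \<open>M\<close>.  Elements of \<open>\<E>\<^sup>+\<close> are the members of \<open>borel_measurable M\<close> of type
  \<open>'a \<Rightarrow> ennreal\<close>; in \<open>ennreal\<close> we have \<open>0 * \<infinity> = 0\<close>.
  Values of functions outside \<open>space M\<close> are irrelevant throughout.
\<close>

definition strictly_positive :: "'a measure \<Rightarrow> ('a \<Rightarrow> ennreal) \<Rightarrow> bool" where
  "strictly_positive M q \<longleftrightarrow> (\<forall>x\<in>space M. q x > 0)"

subsection \<open>The Banach space of bounded measurable functions\<close>

text \<open>
  \<open>Met_TC.fspace S\<close> is the space of bounded functions on \<open>S\<close> and \<open>Met_TC.fdist S\<close> its supremum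
  metric. Its elements are extensional (\<open>undefined\<close> outside \<open>S\<close>), so that equality of elements is
  equality of functions on \<open>S\<close>; hence the restrictions to \<open>space M\<close> below.
\<close>

definition bounded_measurable :: "'a measure \<Rightarrow> ('a \<Rightarrow> real) set" where
  "bounded_measurable M = Met_TC.fspace (space M) \<inter> borel_measurable M"

definition sup_dist :: "'a measure \<Rightarrow> ('a \<Rightarrow> real) \<Rightarrow> ('a \<Rightarrow> real) \<Rightarrow> real" where
  "sup_dist M = Met_TC.fdist (space M)"

lemma mem_bounded_measurable_iff:
  "f \<in> bounded_measurable M \<longleftrightarrow>
     f \<in> borel_measurable M \<and> f \<in> extensional (space M) \<and> bounded (f ` space M)"
  by (auto simp: bounded_measurable_def Met_TC.fspace_def)

lemma Metric_space_bounded_measurable: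
  "Metric_space (bounded_measurable M) (sup_dist M)"
  unfolding bounded_measurable_def sup_dist_def
  by (rule Metric_space.subspace[OF Met_TC.Metric_space_funspace]) auto

lemma sup_dist_eq:
  assumes "f \<in> bounded_measurable M" "g \<in> bounded_measurable M" "space M \<noteq> {}"
  shows "sup_dist M f g = (SUP x\<in>space M. \<bar>f x - g x\<bar>)"
  using assms by (simp add: sup_dist_def bounded_measurable_def Met_TC.fdist_def dist_real_def)

text \<open>A compact operator is a linear map taking the closed unit ball to a relatively compact set.\<close>

definition linear_operator :: "'a measure \<Rightarrow> (('a \<Rightarrow> real) \<Rightarrow> ('a \<Rightarrow> real)) \<Rightarrow> bool" where
  "linear_operator M T \<longleftrightarrow>
     T \<in> bounded_measurable M \<rightarrow> bounded_measurable M \<and>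
     (\<forall>f\<in>bounded_measurable M. \<forall>g\<in>bounded_measurable M. \<forall>a b.
        \<forall>x\<in>space M. T (\<lambda>x\<in>space M. a * f x + b * g x) x = a * T f x + b * T g x)"

definition compact_operator :: "'a measure \<Rightarrow> (('a \<Rightarrow> real) \<Rightarrow> ('a \<Rightarrow> real)) \<Rightarrow> bool" where
  "compact_operator M T \<longleftrightarrow>
     linear_operator M T \<and>
     (let X = Metric_space.mtopology (bounded_measurable M) (sup_dist M);
          B = Metric_space.mcball (bounded_measurable M) (sup_dist M) (\<lambda>x\<in>space M. 0) 1
      in compactin X (X closure_of (T ` B)))"

subsection \<open>Potentials and the associated operators\<close>

definition potential :: "'a measure \<Rightarrow> ('a \<Rightarrow> 'a \<Rightarrow> ennreal) \<Rightarrow> ('a \<Rightarrow> ennreal) \<Rightarrow> 'a \<Rightarrow> ennreal" where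
  "potential M G f x = (\<integral>\<^sup>+ y. G x y * f y \<partial>M)"

definition bounded_potential :: "'a measure \<Rightarrow> ('a \<Rightarrow> 'a \<Rightarrow> ennreal) \<Rightarrow> ('a \<Rightarrow> ennreal) \<Rightarrow> bool" where
  "bounded_potential M G q \<longleftrightarrow> (\<exists>C::real. \<forall>x\<in>space M. potential M G q x \<le> ennreal C)"

text \<open>
  The integrand \<open>G x y * f y * q y\<close> of \<open>K\<^sub>q f x\<close> is extended real valued, with positive and negative
  parts \<open>G x y * (f\<^sup>+ y * q y)\<close> and \<open>G x y * (f\<^sup>- y * q y)\<close>. Its integral is the difference of the
  integrals of these parts, which are finite for bounded \<open>f\<close> if the potential of \<open>q\<close> is bounded.
  As \<open>ennreal\<close> maps negative numbers to \<open>0\<close>, \<open>ennreal (f y)\<close> is \<open>f\<^sup>+ y\<close> and \<open>ennreal (- f y)\<close> is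
  \<open>f\<^sup>- y\<close>.
\<close>

definition K_op ::
    "'a measure \<Rightarrow> ('a \<Rightarrow> 'a \<Rightarrow> ennreal) \<Rightarrow> ('a \<Rightarrow> ennreal) \<Rightarrow> ('a \<Rightarrow> real) \<Rightarrow> 'a \<Rightarrow> real" where
  "K_op M G q f = (\<lambda>x\<in>space M.
     enn2real (potential M G (\<lambda>y. ennreal (f y) * q y) x) -
     enn2real (potential M G (\<lambda>y. ennreal (- f y) * q y) x))"

definition F_co :: "'a measure \<Rightarrow> ('a \<Rightarrow> 'a \<Rightarrow> ennreal) \<Rightarrow> ('a \<Rightarrow> ennreal) set" where
  "F_co M G = {q \<in> borel_measurable M. bounded_potential M G q \<and> compact_operator M (K_op M G q)}"

subsection \<open>Uniform integrability\<close>

definition unif_integrable :: "'a measure \<Rightarrow> ('a \<Rightarrow> ennreal) set \<Rightarrow> bool" where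
  "unif_integrable M F \<longleftrightarrow>
     F \<subseteq> borel_measurable M \<and>
     (\<forall>\<epsilon>::real. \<epsilon> > 0 \<longrightarrow>
        (\<exists>g \<in> borel_measurable M. (\<integral>\<^sup>+ y. g y \<partial>M) < \<infinity> \<and>
           (\<forall>f\<in>F. (\<integral>\<^sup>+ y \<in> {y \<in> space M. f y \<ge> g y}. f y \<partial>M) \<le> ennreal \<epsilon>)))"

definition F_ui :: "'a measure \<Rightarrow> ('a \<Rightarrow> 'a \<Rightarrow> ennreal) \<Rightarrow> ('a \<Rightarrow> ennreal) set" where
  "F_ui M G = {q \<in> borel_measurable M. unif_integrable M {(\<lambda>y. G x y * q y) | x. x \<in> space M}}"

end

theory Submission
  imports Defs
begin

text \<open>
  Compactness of \<open>K\<^sub>q\<close> on the bounded functions means, dually, that the densities \<open>G(x, \<cdot>) q\<close> are totally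
  bounded in \<open>L\<^sup>1(\<mu>)\<close>: points \<open>x\<close>, \<open>z\<close> that a finite net of \<open>K\<^sub>q\<close>(unit ball) does not distinguish have
  \<open>L\<^sup>1\<close>-close densities, as one sees by testing with the sign of the difference. A totally bounded
  subset of \<open>L\<^sup>1\<close> is uniformly integrable, dominated by twice the sum of the densities at the net points.
  Conversely let \<open>p \<in> \<F>\<^sub>c\<^sub>o\<close> be strictly positive and put \<open>r = q/p\<close>. The operators
  \<open>f \<mapsto> K\<^sub>p(f r 1\<^bsub>{r \<le> n}\<^esub>) = K\<^sub>q(f 1\<^bsub>{r \<le> n}\<^esub>)\<close> are compact, and uniform integrability makes them converge to
  \<open>K\<^sub>q\<close> in operator norm.
\<close>

section \<open>The Banach space of bounded measurable functions and a net criterion for compact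
  operators\<close>

lemma sup_dist_le_iff:
  assumes "f \<in> bounded_measurable M" "g \<in> bounded_measurable M" "0 \<le> a"
  shows "sup_dist M f g \<le> a \<longleftrightarrow> (\<forall>x\<in>space M. \<bar>f x - g x\<bar> \<le> a)"
proof (cases "space M = {}")
  case True
  then show ?thesis
    using assms by (simp add: sup_dist_def)
next
  case False
  then show ?thesis
    using assms Met_TC.funspace_mdist_le[of f "space M" g a]
    by (simp add: sup_dist_def bounded_measurable_def dist_real_def)
qed

lemma restrict_bounded_measurable:
  assumes "f \<in> borel_measurable M" "\<And>x. x \<in> space M \<Longrightarrow> \<bar>f x\<bar> \<le> c"
  shows "restrict f (space M) \<in> bounded_measurable M"
proof -
  have "restrict f (space M) \<in> borel_measurable M"
    using assms(1) measurable_cong[of M f "restrict f (space M)" borel] by simp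
  moreover have "bounded (restrict f (space M) ` space M)"
    using assms(2) by (auto simp: bounded_iff)
  ultimately show ?thesis
    by (simp add: mem_bounded_measurable_iff)
qed

lemma bounded_measurableE:
  assumes "f \<in> bounded_measurable M"
  obtains c where "0 < c" "\<And>x. x \<in> space M \<Longrightarrow> \<bar>f x\<bar> \<le> c"
  using assms unfolding mem_bounded_measurable_iff bounded_pos by auto

text \<open>A uniform limit of measurable functions is also a pointwise limit, hence measurable, so
  these functions form a closed subspace of the complete space of all bounded functions.
  Completeness turns compactness of a closure into total boundedness.\<close>

lemma mcomplete_bounded_measurable:
  "Metric_space.mcomplete (bounded_measurable M) (sup_dist M)"
proof -
  interpret F: Metric_space "Met_TC.fspace (space M) :: ('a \<Rightarrow> real) set" "Met_TC.fdist (space M)"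
    by (rule Met_TC.Metric_space_funspace)
  interpret S: Submetric "Met_TC.fspace (space M) :: ('a \<Rightarrow> real) set" "Met_TC.fdist (space M)"
    "bounded_measurable M"
    by unfold_locales (simp add: bounded_measurable_def)
  have "F.mcomplete"
    using Met_TC.mcomplete_funspace[where 'a = real, of "space M"]
    by (simp add: mcomplete_of_def complete_UNIV)
  moreover have "closedin F.mtopology (bounded_measurable M)"
    unfolding F.metric_closedin_iff_sequentially_closed
  proof (intro conjI allI impI, goal_cases)
    case 1
    then show ?case by (simp add: bounded_measurable_def)
  next
    case (2 s l)
    then have s: "\<And>n. s n \<in> bounded_measurable M"
      and l: "l \<in> Met_TC.fspace (space M)"
      and lim: "(\<lambda>n. Met_TC.fdist (space M) (s n) l) \<longlonglongrightarrow> 0"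
      by (auto simp: F.limitin_metric_dist_null)
    have "(\<lambda>n. s n x) \<longlonglongrightarrow> l x" if x: "x \<in> space M" for x
    proof (rule metric_LIMSEQ_I)
      fix e :: real assume "e > 0"
      then obtain N where N: "\<And>n. n \<ge> N \<Longrightarrow> Met_TC.fdist (space M) (s n) l < e"
        using LIMSEQ_D[OF lim, of e] by (fastforce simp: abs_less_iff)
      have "dist (s n x) (l x) < e" if "n \<ge> N" for n
      proof -
        have "s n \<in> Met_TC.fspace (space M)"
          using s[of n] by (simp add: bounded_measurable_def)
        then have "dist (s n x) (l x) \<le> Met_TC.fdist (space M) (s n) l"
          using Met_TC.funspace_mdist_le[OF _ l, of "s n"] x by auto
        then show ?thesis using N[OF that] by simp
      qed
      then show "\<exists>N. \<forall>n\<ge>N. dist (s n x) (l x) < e" by blast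
    qed
    then have "l \<in> borel_measurable M"
      using s by (intro borel_measurable_LIMSEQ_real[of M s l]) (auto simp: bounded_measurable_def)
    then show ?case using l by (simp add: bounded_measurable_def)
  qed
  ultimately have "S.sub.mcomplete"
    using S.closedin_eq_mcomplete by blast
  then show ?thesis by (simp add: sup_dist_def)
qed

lemma mcball_bounded_measurable:
  "Metric_space.mcball (bounded_measurable M) (sup_dist M) (\<lambda>x\<in>space M. 0) 1 =
     {f \<in> bounded_measurable M. \<forall>x\<in>space M. \<bar>f x\<bar> \<le> 1}"
proof -
  interpret Metric_space "bounded_measurable M" "sup_dist M"
    by (rule Metric_space_bounded_measurable)
  have z: "(\<lambda>x\<in>space M. 0) \<in> bounded_measurable M"
    by (rule restrict_bounded_measurable[of _ _ 0]) auto
  show ?thesis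
    unfolding mcball_def using z sup_dist_le_iff[OF z, of _ 1] by auto
qed

text \<open>In a complete metric space, relative compactness is total boundedness. The centres in
  \<open>K\<close> may lie anywhere in the space and not only in the image of the ball, so a net for
  one operator can be rescaled and reused for a nearby operator.\<close>

lemma compact_operator_iff:
  "compact_operator M T \<longleftrightarrow> linear_operator M T \<and>
     (\<forall>e>0. \<exists>K. finite K \<and> K \<subseteq> bounded_measurable M \<and>
        (\<forall>f\<in>bounded_measurable M. (\<forall>x\<in>space M. \<bar>f x\<bar> \<le> 1) \<longrightarrow>
           (\<exists>k\<in>K. \<forall>x\<in>space M. \<bar>T f x - k x\<bar> \<le> e)))"
    (is "_ \<longleftrightarrow> _ \<and> ?net")
proof (cases "linear_operator M T")
  case True
  interpret Metric_space "bounded_measurable M" "sup_dist M"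
    by (rule Metric_space_bounded_measurable)
  define B where "B = {f \<in> bounded_measurable M. \<forall>x\<in>space M. \<bar>f x\<bar> \<le> 1}"
  have TB: "T ` B \<subseteq> bounded_measurable M"
    using True by (auto simp: linear_operator_def B_def)
  have "compact_operator M T \<longleftrightarrow> compactin mtopology (mtopology closure_of (T ` B))"
    using True by (simp add: compact_operator_def mcball_bounded_measurable B_def Let_def)
  also have "\<dots> \<longleftrightarrow> mtotally_bounded (T ` B)"
    using mtotally_bounded_eq_compact_closure_of[OF mcomplete_bounded_measurable] TB by blast
  also have "\<dots> \<longleftrightarrow> ?net"
  proof
    assume tb: "mtotally_bounded (T ` B)"
    show ?net
    proof (intro allI impI)
      fix e :: real assume "e > 0"
      then obtain K where K: "finite K" "K \<subseteq> T ` B" "T ` B \<subseteq> (\<Union>k\<in>K. mball k e)"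
        using tb[unfolded mtotally_bounded_def, rule_format, of e] by auto
      have "\<exists>k\<in>K. \<forall>x\<in>space M. \<bar>T f x - k x\<bar> \<le> e"
        if f: "f \<in> B" for f
      proof -
        obtain k where k: "k \<in> K" "T f \<in> mball k e"
          using K(3) f by blast
        then have "sup_dist M (T f) k \<le> e" "k \<in> bounded_measurable M" "T f \<in> bounded_measurable M"
          by (auto simp: in_mball commute)
        with \<open>e > 0\<close> have "\<forall>x\<in>space M. \<bar>T f x - k x\<bar> \<le> e"
          using sup_dist_le_iff[of "T f" M k e] by simp
        then show ?thesis using k(1) by (rule bexI[of _ k])
      qed
      moreover have "K \<subseteq> bounded_measurable M" using K(2) TB by (rule order_trans)
      ultimately show "\<exists>K. finite K \<and> K \<subseteq> bounded_measurable M \<and>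
        (\<forall>f\<in>bounded_measurable M. (\<forall>x\<in>space M. \<bar>f x\<bar> \<le> 1) \<longrightarrow>
           (\<exists>k\<in>K. \<forall>x\<in>space M. \<bar>T f x - k x\<bar> \<le> e))"
        using K(1) by (intro exI[of _ K] conjI ballI impI) (simp_all add: B_def)
    qed
  next
    assume net: ?net
    show "mtotally_bounded (T ` B)"
      unfolding mtotally_bounded_def
    proof (intro allI impI)
      fix e :: real assume "e > 0"
      then obtain K where K: "finite K" "K \<subseteq> bounded_measurable M"
        "\<And>f. f \<in> B \<Longrightarrow> \<exists>k\<in>K. \<forall>x\<in>space M. \<bar>T f x - k x\<bar> \<le> e / 3"
        using net[rule_format, of "e / 3"] unfolding B_def by auto
      \<comment> \<open>Total boundedness asks for centres inside the image of the ball. A centre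
        \<open>k\<close> close to some image is replaced by one such image \<open>T (c k)\<close>,
        and the other centres are dropped. The two errors of \<open>e / 3\<close> stay strictly
        below \<open>e\<close>, as open balls require.\<close>
      define near where "near f k \<longleftrightarrow> (\<forall>x\<in>space M. \<bar>T f x - k x\<bar> \<le> e / 3)" for f k
      define K' where "K' = {k \<in> K. \<exists>f\<in>B. near f k}"
      have "\<forall>k\<in>K'. \<exists>f. f \<in> B \<and> near f k" by (auto simp: K'_def)
      then obtain c where c: "\<And>k. k \<in> K' \<Longrightarrow> c k \<in> B \<and> near (c k) k"
        by metis
      have "\<exists>k\<in>K'. T f \<in> mball (T (c k)) e" if f: "f \<in> B" for f
      proof -
        obtain k where k: "k \<in> K" "near f k"
          using K(3)[OF f] by (auto simp: near_def)
        then have k': "k \<in> K'" using f by (auto simp: K'_def)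
        have "\<bar>T (c k) x - T f x\<bar> \<le> 2 * e / 3" if "x \<in> space M" for x
        proof -
          have "\<bar>T f x - k x\<bar> \<le> e / 3" "\<bar>T (c k) x - k x\<bar> \<le> e / 3"
            using k(2) c[OF k'] that by (auto simp: near_def)
          then show ?thesis by linarith
        qed
        moreover have "T f \<in> bounded_measurable M" "T (c k) \<in> bounded_measurable M"
          using TB f c[OF k'] by auto
        ultimately have "T f \<in> mball (T (c k)) e"
          using \<open>e > 0\<close> sup_dist_le_iff[of "T (c k)" M "T f" "2 * e / 3"] by auto
        with k' show ?thesis by blast
      qed
      moreover have "finite K'" using K(1) by (simp add: K'_def)
      ultimately show "\<exists>K. finite K \<and> K \<subseteq> T ` B \<and> T ` B \<subseteq> (\<Union>x\<in>K. mball x e)"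
        using c by (intro exI[of _ "(\<lambda>k. T (c k)) ` K'"]) auto
    qed
  qed
  finally show ?thesis using True by simp
qed (simp add: compact_operator_def)

section \<open>Real-valued densities of the operators\<close>

text \<open>
  Where \<open>G x y * q y = \<infinity>\<close> the density is \<open>0\<close>; if \<open>Gq(x) < \<infinity>\<close> this happens only on a null set.
\<close>

definition kernel_density :: "('a \<Rightarrow> 'a \<Rightarrow> ennreal) \<Rightarrow> ('a \<Rightarrow> ennreal) \<Rightarrow> 'a \<Rightarrow> 'a \<Rightarrow> real" where
  "kernel_density G q x y = enn2real (G x y * q y)"

lemma kernel_density_nonneg [simp]: "0 \<le> kernel_density G q x y"
  by (simp add: kernel_density_def)

lemma kernel_density_measurable [measurable]:
  assumes [measurable]: "G x \<in> borel_measurable M" "q \<in> borel_measurable M"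
  shows "kernel_density G q x \<in> borel_measurable M"
  unfolding kernel_density_def[abs_def] by measurable

lemma AE_ennreal_kernel_density:
  assumes [measurable]: "G x \<in> borel_measurable M" "q \<in> borel_measurable M"
    and "potential M G q x < \<infinity>"
  shows "AE y in M. ennreal (kernel_density G q x y) = G x y * q y"
proof -
  have "AE y in M. G x y * q y \<noteq> \<infinity>"
    using assms(3) unfolding potential_def by (intro nn_integral_PInf_AE) auto
  then show ?thesis
    by eventually_elim (simp add: kernel_density_def less_top)
qed

lemma integrable_kernel_density:
  assumes [measurable]: "G x \<in> borel_measurable M" "q \<in> borel_measurable M"
    and fin: "potential M G q x < \<infinity>"
  shows "integrable M (kernel_density G q x)"
proof (rule integrableI_nonneg)
  have "(\<integral>\<^sup>+ y. ennreal (kernel_density G q x y) \<partial>M) = potential M G q x"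
    unfolding potential_def
    by (rule nn_integral_cong_AE) (rule AE_ennreal_kernel_density[OF assms])
  then show "(\<integral>\<^sup>+ y. ennreal (kernel_density G q x y) \<partial>M) < \<infinity>"
    using fin by simp
qed simp_all

lemma integrable_mult_kernel_density:
  assumes [measurable]: "G x \<in> borel_measurable M" "q \<in> borel_measurable M" "f \<in> borel_measurable M"
    and fin: "potential M G q x < \<infinity>" and f: "\<And>y. y \<in> space M \<Longrightarrow> \<bar>f y\<bar> \<le> c"
  shows "integrable M (\<lambda>y. f y * kernel_density G q x y)"
proof (rule Bochner_Integration.integrable_bound)
  show "integrable M (\<lambda>y. c * kernel_density G q x y)"
    using integrable_kernel_density[OF assms(1,2,4)] by simp
  show "AE y in M. norm (f y * kernel_density G q x y) \<le> norm (c * kernel_density G q x y)"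
  proof (rule AE_I2)
    fix y assume "y \<in> space M"
    from f[OF this] have "\<bar>f y\<bar> \<le> \<bar>c\<bar>" by linarith
    then show "norm (f y * kernel_density G q x y) \<le> norm (c * kernel_density G q x y)"
      by (simp add: abs_mult mult_right_mono)
  qed
qed simp

text \<open>Off a null set the density is \<open>G x y * q y\<close>, so the two extended-valued
  integrals in \<open>K_op\<close> are those of the positive and negative parts of one integrable
  real function. From here on, linearity and estimates come from the Bochner integral.\<close>

lemma K_op_eq_integral:
  assumes [measurable]: "G x \<in> borel_measurable M" "q \<in> borel_measurable M"
    and fin: "potential M G q x < \<infinity>" and f: "f \<in> bounded_measurable M" and x: "x \<in> space M"
  shows "K_op M G q f x = (\<integral>y. f y * kernel_density G q x y \<partial>M)"
proof -
  have [measurable]: "f \<in> borel_measurable M" using f by (simp add: bounded_measurable_def)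
  obtain c where c: "\<And>y. y \<in> space M \<Longrightarrow> \<bar>f y\<bar> \<le> c"
    using bounded_measurableE[OF f] by blast
  have int: "integrable M (\<lambda>y. f y * kernel_density G q x y)"
    by (rule integrable_mult_kernel_density[OF assms(1,2) _ fin c]) simp_all
  \<comment> \<open>The values \<open>s = 1\<close> and \<open>s = -1\<close> give the positive and
    the negative part, so both are treated at once.\<close>
  have part: "potential M G (\<lambda>y. ennreal (s * f y) * q y) x =
      (\<integral>\<^sup>+ y. ennreal (s * (f y * kernel_density G q x y)) \<partial>M)" for s
    unfolding potential_def
  proof (rule nn_integral_cong_AE, use AE_ennreal_kernel_density[OF assms(1,2,3)] in eventually_elim)
    case (elim y)
    show ?case
    proof (cases "0 \<le> s * f y")
      case True
      have "G x y * (ennreal (s * f y) * q y) = ennreal (s * f y) * (G x y * q y)"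
        by (rule mult.left_commute)
      also have "\<dots> = ennreal (s * f y * kernel_density G q x y)"
        using True by (simp only: elim[symmetric] ennreal_mult kernel_density_nonneg)
      finally show ?thesis by (simp only: mult.assoc)
    next
      case False
      then have "s * (f y * kernel_density G q x y) \<le> 0"
        by (simp add: mult.assoc[symmetric] mult_nonpos_nonneg)
      with False show ?thesis by (simp add: ennreal_neg)
    qed
  qed
  show ?thesis
    using x part[of 1] part[of "-1"] by (simp add: K_op_def real_lebesgue_integral_def[OF int])
qed

section \<open>Compactness implies uniform integrability\<close>

text \<open>The points are classified by the integer parts of \<open>k x / e\<close>, which take finitely many values.\<close>

lemma finite_representatives:
  fixes K :: "('a \<Rightarrow> real) set"
  assumes "finite K" "\<forall>k\<in>K. bounded (k ` S)" "0 < e"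
  shows "\<exists>X. finite X \<and> X \<subseteq> S \<and> (\<forall>x\<in>S. \<exists>z\<in>X. \<forall>k\<in>K. \<bar>k x - k z\<bar> \<le> e)"
proof -
  define \<phi> where "\<phi> x = (\<lambda>k\<in>K. \<lfloor>k x / e\<rfloor>)" for x
  have "\<exists>n::int. \<forall>x\<in>S. \<lfloor>k x / e\<rfloor> \<in> {-n..n}" if k: "k \<in> K" for k
  proof -
    obtain b where b: "\<And>x. x \<in> S \<Longrightarrow> \<bar>k x\<bar> \<le> b"
      using bspec[OF assms(2) k] unfolding bounded_iff by auto
    have "\<lfloor>k x / e\<rfloor> \<in> {- \<lceil>b / e\<rceil>..\<lceil>b / e\<rceil>}" if "x \<in> S" for x
    proof -
      have "k x / e \<le> b / e" "- (b / e) \<le> k x / e"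
        using b[OF that] assms(3) by (auto simp: field_simps)
      then have "\<lfloor>k x / e\<rfloor> \<le> \<lceil>b / e\<rceil>" "- \<lceil>b / e\<rceil> \<le> \<lfloor>k x / e\<rfloor>"
        by linarith+
      then show ?thesis by simp
    qed
    then show ?thesis by blast
  qed
  then have "\<forall>k\<in>K. \<exists>n::int. \<forall>x\<in>S. \<lfloor>k x / e\<rfloor> \<in> {-n..n}"
    by blast
  from bchoice[OF this] obtain n :: "('a \<Rightarrow> real) \<Rightarrow> int"
    where n: "\<forall>k\<in>K. \<forall>x\<in>S. \<lfloor>k x / e\<rfloor> \<in> {- n k..n k}" ..
  have "\<phi> ` S \<subseteq> (\<Pi>\<^sub>E k\<in>K. {- n k..n k})"
    using n by (auto simp: \<phi>_def)
  then have "finite (\<phi> ` S)"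
    by (rule finite_subset) (simp add: finite_PiE assms(1))
  \<comment> \<open>One representative in \<open>S\<close> is kept for each class that
    occurs.\<close>
  from finite_subset_image[OF this order_refl]
  obtain X where X: "X \<subseteq> S" "finite X" and eq: "\<phi> ` S = \<phi> ` X"
    by (elim exE conjE)
  have "\<exists>z\<in>X. \<forall>k\<in>K. \<bar>k x - k z\<bar> \<le> e" if "x \<in> S" for x
  proof -
    have "\<phi> x \<in> \<phi> ` X" using that by (simp flip: eq)
    then obtain z where z: "\<phi> x = \<phi> z" "z \<in> X" ..
    have "\<bar>k x - k z\<bar> \<le> e" if "k \<in> K" for k
    proof -
      have "\<lfloor>k x / e\<rfloor> = \<lfloor>k z / e\<rfloor>"
        using fun_cong[OF z(1), of k] that by (simp add: \<phi>_def)
      then have "\<bar>k x / e - k z / e\<bar> \<le> 1" by linarith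
      then have "\<bar>(k x - k z) / e\<bar> \<le> 1" by (simp add: diff_divide_distrib)
      then show ?thesis using assms(3) by (simp add: abs_divide)
    qed
    with z(2) show ?thesis by blast
  qed
  with X show ?thesis by blast
qed

text \<open>A net of functions becomes a net of points: the finitely many bounded functions in
  \<open>K\<close> distinguish only finitely many classes of points up to a given error. Since
  \<open>K\<close> serves all test functions in the unit ball at once, the test function may depend
  on the pair \<open>x\<close>, \<open>z\<close>.\<close>

lemma kernel_density_L1_net:
  assumes G: "\<forall>x\<in>space M. G x \<in> borel_measurable M"
    and q: "q \<in> F_co M G" and "0 < e"
  shows "\<exists>X. finite X \<and> X \<subseteq> space M \<and> (\<forall>x\<in>space M. \<exists>z\<in>X.
    (\<integral>y. \<bar>kernel_density G q x y - kernel_density G q z y\<bar> \<partial>M) \<le> e)"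
proof -
  have qm [measurable]: "q \<in> borel_measurable M" and co: "compact_operator M (K_op M G q)"
    and fin: "\<And>x. x \<in> space M \<Longrightarrow> potential M G q x < \<infinity>"
    using q by (auto simp: F_co_def bounded_potential_def intro: le_less_trans)
  \<comment> \<open>Two thirds are spent on approximating the image function at \<open>x\<close> and
    at \<open>z\<close> by some \<open>k\<close>, one third on the variation of \<open>k\<close>
    between them.\<close>
  have "0 < e / 3" using \<open>0 < e\<close> by simp
  obtain K where K: "finite K" "K \<subseteq> bounded_measurable M"
    "\<forall>f\<in>bounded_measurable M. (\<forall>x\<in>space M. \<bar>f x\<bar> \<le> 1) \<longrightarrow>
       (\<exists>k\<in>K. \<forall>x\<in>space M. \<bar>K_op M G q f x - k x\<bar> \<le> e / 3)"
    using co[unfolded compact_operator_iff, THEN conjunct2, THEN spec, THEN mp, OF \<open>0 < e / 3\<close>]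
    by (elim exE conjE) (rule that)
  have bdd: "\<forall>k\<in>K. bounded (k ` space M)"
    using K(2) by (auto simp: mem_bounded_measurable_iff)
  obtain X where X: "finite X" "X \<subseteq> space M"
    "\<forall>x\<in>space M. \<exists>z\<in>X. \<forall>k\<in>K. \<bar>k x - k z\<bar> \<le> e / 3"
    using finite_representatives[OF K(1) bdd \<open>0 < e / 3\<close>] by (elim exE conjE) (rule that)
  have "(\<integral>y. \<bar>kernel_density G q x y - kernel_density G q z y\<bar> \<partial>M) \<le> e"
    if x: "x \<in> space M" and z: "z \<in> space M" and close: "\<forall>k\<in>K. \<bar>k x - k z\<bar> \<le> e / 3" for x z
  proof -
    note [measurable] = G[rule_format, OF x] G[rule_format, OF z]
    \<comment> \<open>the test function whose image under \<open>K\<^sub>q\<close> separates \<open>x\<close> and \<open>z\<close> by the full \<open>L\<^sup>1\<close> distance\<close>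
    define f where "f = (\<lambda>y\<in>space M. sgn (kernel_density G q x y - kernel_density G q z y))"
    have f: "f \<in> bounded_measurable M"
      unfolding f_def by (rule restrict_bounded_measurable[of _ _ 1]) (auto simp: sgn_if)
    then have [measurable]: "f \<in> borel_measurable M" by (simp add: bounded_measurable_def)
    have f1: "\<bar>f y\<bar> \<le> 1" if "y \<in> space M" for y
      using that by (auto simp: f_def sgn_if)
    obtain k where k: "k \<in> K" "\<forall>x\<in>space M. \<bar>K_op M G q f x - k x\<bar> \<le> e / 3"
      using bspec[OF K(3) f] f1 by blast
    have int: "integrable M (\<lambda>y. f y * kernel_density G q w y)" if "w \<in> {x, z}" for w
      using that x z fin G by (intro integrable_mult_kernel_density[OF _ qm _ _ f1]) auto
    have "(\<integral>y. \<bar>kernel_density G q x y - kernel_density G q z y\<bar> \<partial>M) =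
        (\<integral>y. f y * kernel_density G q x y - f y * kernel_density G q z y \<partial>M)"
      by (rule Bochner_Integration.integral_cong)
        (simp_all add: f_def abs_sgn algebra_simps)
    also have "\<dots> = K_op M G q f x - K_op M G q f z"
      using int x z f fin by (simp add: K_op_eq_integral)
    also have "\<dots> \<le> e"
    proof -
      have "\<bar>K_op M G q f x - k x\<bar> \<le> e / 3" "\<bar>K_op M G q f z - k z\<bar> \<le> e / 3" "\<bar>k x - k z\<bar> \<le> e / 3"
        using k close x z by auto
      then show ?thesis by linarith
    qed
    finally show ?thesis .
  qed
  then have "\<exists>z\<in>X. (\<integral>y. \<bar>kernel_density G q x y - kernel_density G q z y\<bar> \<partial>M) \<le> e"
    if "x \<in> space M" for x
    using bspec[OF X(3) that] X(2) that by (meson subsetD)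
  with X(1,2) show ?thesis by blast
qed

text \<open>Where \<open>G x y * q y\<close> exceeds twice the density at a nearby centre
  \<open>z\<close>, it is almost everywhere at most twice the difference of the two densities, and
  this difference has a small integral. Summing over all centres gives one dominating function for
  all \<open>x\<close>.\<close>

lemma F_co_subset_F_ui:
  assumes G: "\<forall>x\<in>space M. G x \<in> borel_measurable M"
  shows "F_co M G \<subseteq> F_ui M G"
proof
  fix q assume q: "q \<in> F_co M G"
  then have qm [measurable]: "q \<in> borel_measurable M"
    and fin: "\<And>x. x \<in> space M \<Longrightarrow> potential M G q x < \<infinity>"
    by (auto simp: F_co_def bounded_potential_def intro: le_less_trans)
  have "\<exists>g\<in>borel_measurable M. (\<integral>\<^sup>+ y. g y \<partial>M) < \<infinity> \<and>
      (\<forall>x\<in>space M. (\<integral>\<^sup>+ y \<in> {y \<in> space M. G x y * q y \<ge> g y}. G x y * q y \<partial>M) \<le> ennreal e)"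
    if "0 < e" for e :: real
  proof -
    \<comment> \<open>Half of \<open>e\<close> compensates for the factor 2 in front of the
      difference of the densities.\<close>
    have "0 < e / 2" using that by simp
    obtain X where X: "finite X" "X \<subseteq> space M"
      "\<forall>x\<in>space M. \<exists>z\<in>X. (\<integral>y. \<bar>kernel_density G q x y - kernel_density G q z y\<bar> \<partial>M) \<le> e / 2"
      using kernel_density_L1_net[OF G q \<open>0 < e / 2\<close>] by (elim exE conjE) (rule that)
    have GX: "\<And>z. z \<in> X \<Longrightarrow> G z \<in> borel_measurable M" using X(2) G by blast
    define g where "g y = (\<Sum>z\<in>X. 2 * (G z y * q y))" for y
    have gm [measurable]: "g \<in> borel_measurable M"
      unfolding g_def[abs_def]
      by (intro borel_measurable_sum borel_measurable_times_ennreal borel_measurable_const qm GX)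
    have "(\<integral>\<^sup>+ y. g y \<partial>M) = (\<Sum>z\<in>X. \<integral>\<^sup>+ y. 2 * (G z y * q y) \<partial>M)"
      unfolding g_def[abs_def]
      by (intro nn_integral_sum borel_measurable_times_ennreal borel_measurable_const qm GX)
    also have "\<dots> = (\<Sum>z\<in>X. 2 * potential M G q z)"
      unfolding potential_def
      by (intro sum.cong refl nn_integral_cmult borel_measurable_times_ennreal qm GX)
    also have "\<dots> < \<infinity>"
      using X(2) fin by (auto simp: X(1) ennreal_mult_less_top subset_iff)
    finally have g_fin: "(\<integral>\<^sup>+ y. g y \<partial>M) < \<infinity>" .
    have "(\<integral>\<^sup>+ y \<in> {y \<in> space M. G x y * q y \<ge> g y}. G x y * q y \<partial>M) \<le> ennreal e"
      if x: "x \<in> space M" for x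
    proof -
      obtain z where z: "z \<in> X"
        and zx: "(\<integral>y. \<bar>kernel_density G q x y - kernel_density G q z y\<bar> \<partial>M) \<le> e / 2"
        using bspec[OF X(3) x] by (elim bexE)
      have zM: "z \<in> space M" using z X(2) by blast
      note Gx [measurable] = bspec[OF G x] and Gz [measurable] = bspec[OF G zM]
      let ?d = "\<lambda>y. \<bar>kernel_density G q x y - kernel_density G q z y\<bar>"
      have "(\<integral>\<^sup>+ y \<in> {y \<in> space M. G x y * q y \<ge> g y}. G x y * q y \<partial>M)
          \<le> (\<integral>\<^sup>+ y. ennreal (2 * ?d y) \<partial>M)"
      proof (rule nn_integral_mono_AE, use AE_ennreal_kernel_density[OF Gx qm fin[OF x]]
          AE_ennreal_kernel_density[OF Gz qm fin[OF zM]] in eventually_elim)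
        case (elim y)
        show ?case
        proof (cases "g y \<le> G x y * q y")
          case True
          have "2 * (G z y * q y) \<le> g y"
            unfolding g_def using z X(1) by (intro member_le_sum) auto
          with True have "2 * ennreal (kernel_density G q z y) \<le> ennreal (kernel_density G q x y)"
            using elim by simp
          then have "ennreal (2 * kernel_density G q z y) \<le> ennreal (kernel_density G q x y)"
            by (simp add: ennreal_mult)
          then have "2 * kernel_density G q z y \<le> kernel_density G q x y"
            by (simp add: ennreal_le_iff)
          \<comment> \<open>the factor 2 in \<open>g\<close> makes the density large only where it differs much from its centre\<close>
          then have "kernel_density G q x y \<le> 2 * ?d y"
            by (simp add: abs_if)
          then show ?thesis
            using elim by (auto simp: indicator_def intro!: ennreal_leI simp flip: elim(1))
        qed (simp add: indicator_def)
      qed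
      also have "\<dots> = ennreal (2 * (\<integral>y. ?d y \<partial>M))"
        using integrable_kernel_density[OF Gx qm fin[OF x]]
          integrable_kernel_density[OF Gz qm fin[OF zM]]
        by (subst nn_integral_eq_integral) auto
      also have "\<dots> \<le> ennreal e"
        using zx by (intro ennreal_leI) simp
      finally show ?thesis .
    qed
    with gm g_fin show ?thesis by blast
  qed
  moreover have "{(\<lambda>y. G x y * q y) | x. x \<in> space M} \<subseteq> borel_measurable M"
    using G by auto
  ultimately have "unif_integrable M {(\<lambda>y. G x y * q y) | x. x \<in> space M}"
    unfolding unif_integrable_def by fast
  then show "q \<in> F_ui M G" by (simp add: F_ui_def)
qed

section \<open>Uniform integrability: bounded potentials and uniformly small tails\<close>

lemma F_uiE:
  fixes e :: real
  assumes "q \<in> F_ui M G" "0 < e"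
  obtains g where "g \<in> borel_measurable M" "(\<integral>\<^sup>+ y. g y \<partial>M) < \<infinity>"
    "\<forall>x\<in>space M. (\<integral>\<^sup>+ y \<in> {y \<in> space M. G x y * q y \<ge> g y}. G x y * q y \<partial>M) \<le> ennreal e"
proof -
  have "unif_integrable M {(\<lambda>y. G x y * q y) | x. x \<in> space M}"
    using assms(1) by (simp add: F_ui_def)
  from this[unfolded unif_integrable_def, THEN conjunct2, THEN spec, THEN mp, OF assms(2)]
  obtain g where g: "g \<in> borel_measurable M" "(\<integral>\<^sup>+ y. g y \<partial>M) < \<infinity>"
    "\<forall>f\<in>{(\<lambda>y. G x y * q y) | x. x \<in> space M}.
       (\<integral>\<^sup>+ y \<in> {y \<in> space M. f y \<ge> g y}. f y \<partial>M) \<le> ennreal e"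
    by (elim bexE conjE)
  show thesis
  proof (rule that[OF g(1,2)], rule ballI)
    fix x assume "x \<in> space M"
    then have "(\<lambda>y. G x y * q y) \<in> {(\<lambda>y. G x y * q y) | x. x \<in> space M}" by auto
    from bspec[OF g(3) this]
    show "(\<integral>\<^sup>+ y \<in> {y \<in> space M. G x y * q y \<ge> g y}. G x y * q y \<partial>M) \<le> ennreal e" .
  qed
qed

text \<open>Where \<open>f\<close> is at least \<open>g\<close>, the weight \<open>u\<close> is
  estimated by 1; elsewhere \<open>f\<close> is replaced by \<open>g\<close>. The constant weight 1
  will yield bounded potentials, and an indicator as weight will yield small tails.\<close>

lemma nn_integral_split_le:
  fixes f g u :: "'a \<Rightarrow> ennreal"
  assumes [measurable]: "f \<in> borel_measurable M" "g \<in> borel_measurable M" "u \<in> borel_measurable M"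
    and u: "\<And>y. u y \<le> 1"
  shows "(\<integral>\<^sup>+ y. f y * u y \<partial>M) \<le> (\<integral>\<^sup>+ y \<in> {y \<in> space M. f y \<ge> g y}. f y \<partial>M) + (\<integral>\<^sup>+ y. g y * u y \<partial>M)"
proof -
  have "(\<integral>\<^sup>+ y. f y * u y \<partial>M)
      \<le> (\<integral>\<^sup>+ y. f y * indicator {y \<in> space M. f y \<ge> g y} y + g y * u y \<partial>M)"
  proof (rule nn_integral_mono)
    fix y assume y: "y \<in> space M"
    show "f y * u y \<le> f y * indicator {y \<in> space M. f y \<ge> g y} y + g y * u y"
    proof (cases "g y \<le> f y")
      case True
      have "f y * u y \<le> f y" using mult_left_mono[OF u[of y], of "f y"] by simp
      with True y show ?thesis by (simp add: add_increasing2)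
    next
      case False
      then show ?thesis using y by (simp add: mult_right_mono)
    qed
  qed
  also have "\<dots> = (\<integral>\<^sup>+ y \<in> {y \<in> space M. f y \<ge> g y}. f y \<partial>M) + (\<integral>\<^sup>+ y. g y * u y \<partial>M)"
    by (rule nn_integral_add) measurable
  finally show ?thesis .
qed

text \<open>A single level suffices: for \<epsilon> = 1 the potential is at most 1 plus the integral
  of \<open>g\<close>, a bound independent of \<open>x\<close>.\<close>

lemma F_ui_bounded_potential:
  assumes G: "\<forall>x\<in>space M. G x \<in> borel_measurable M" and q: "q \<in> F_ui M G"
  shows "bounded_potential M G q"
proof -
  have qm [measurable]: "q \<in> borel_measurable M" using q by (simp add: F_ui_def)
  obtain g where g [measurable]: "g \<in> borel_measurable M" and g_fin: "(\<integral>\<^sup>+ y. g y \<partial>M) < \<infinity>"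
    and ui: "\<forall>x\<in>space M. (\<integral>\<^sup>+ y \<in> {y \<in> space M. G x y * q y \<ge> g y}. G x y * q y \<partial>M) \<le> ennreal 1"
    using F_uiE[OF q zero_less_one] .
  have "potential M G q x \<le> ennreal (1 + enn2real (\<integral>\<^sup>+ y. g y \<partial>M))" if x: "x \<in> space M" for x
  proof -
    note [measurable] = bspec[OF G x]
    have "potential M G q x \<le> (\<integral>\<^sup>+ y \<in> {y \<in> space M. G x y * q y \<ge> g y}. G x y * q y \<partial>M)
        + (\<integral>\<^sup>+ y. g y \<partial>M)"
      using nn_integral_split_le[of "\<lambda>y. G x y * q y" M g "\<lambda>_. 1"] by (simp add: potential_def)
    also have "\<dots> \<le> ennreal 1 + (\<integral>\<^sup>+ y. g y \<partial>M)"
      by (rule add_right_mono) (rule bspec[OF ui x])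
    also have "\<dots> = ennreal (1 + enn2real (\<integral>\<^sup>+ y. g y \<partial>M))"
      using g_fin by (subst ennreal_plus) simp_all
    finally show ?thesis .
  qed
  then show ?thesis
    unfolding bounded_potential_def by (intro exI ballI)
qed

text \<open>The sets \<open>{n < r}\<close> decrease to the empty set because \<open>r\<close> is
  real-valued, so the integral of \<open>g\<close> over them tends to 0 by dominated convergence. As
  \<open>g\<close> does not depend on \<open>x\<close>, one \<open>n\<close> works for all
  \<open>x\<close>; the part of the density lying above \<open>g\<close> costs the other
  \<open>e / 2\<close>.\<close>

lemma F_ui_tail:
  fixes r :: "'a \<Rightarrow> real" and e :: real
  assumes G: "\<forall>x\<in>space M. G x \<in> borel_measurable M" and q: "q \<in> F_ui M G"
    and r [measurable]: "r \<in> borel_measurable M" and "0 < e"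
  shows "\<exists>n\<ge>1. \<forall>x\<in>space M.
    (\<integral>y. kernel_density G q x y * indicator {y. real n < r y} y \<partial>M) \<le> e"
proof -
  have qm [measurable]: "q \<in> borel_measurable M" using q by (simp add: F_ui_def)
  have "0 < e / 2" using \<open>0 < e\<close> by simp
  then obtain g where g [measurable]: "g \<in> borel_measurable M"
    and g_fin: "(\<integral>\<^sup>+ y. g y \<partial>M) < \<infinity>"
    and ui: "\<forall>x\<in>space M.
      (\<integral>\<^sup>+ y \<in> {y \<in> space M. G x y * q y \<ge> g y}. G x y * q y \<partial>M) \<le> ennreal (e / 2)"
    by (rule F_uiE[OF q])
  have "(\<lambda>n. \<integral>\<^sup>+ y. g y * indicator {y. real n < r y} y \<partial>M) \<longlonglongrightarrow> (\<integral>\<^sup>+ y. 0 \<partial>M)"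
  proof (rule nn_integral_dominated_convergence[where w = g])
    show "AE y in M. (\<lambda>n. g y * indicator {y. real n < r y} y) \<longlonglongrightarrow> 0"
    proof (rule AE_I2, rule tendsto_eventually)
      fix y
      obtain N where "r y \<le> real N" using real_arch_simple by blast
      then show "eventually (\<lambda>n. g y * indicator {y. real n < r y} y = 0) sequentially"
        by (intro eventually_sequentiallyI[of N]) (auto simp: indicator_def)
    qed
  qed (use g_fin in \<open>auto simp: indicator_def\<close>)
  then have "(\<lambda>n. \<integral>\<^sup>+ y. g y * indicator {y. real n < r y} y \<partial>M) \<longlonglongrightarrow> 0" by simp
  from order_tendstoD(2)[OF this, of "ennreal (e / 2)"] \<open>0 < e\<close>
  have "eventually (\<lambda>n. (\<integral>\<^sup>+ y. g y * indicator {y. real n < r y} y \<partial>M) < ennreal (e / 2)) sequentially"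
    by simp
  \<comment> \<open>A positive \<open>n\<close> is selected because the truncated multiplier will be
    divided by it.\<close>
  then have "eventually (\<lambda>n. (\<integral>\<^sup>+ y. g y * indicator {y. real n < r y} y \<partial>M) < ennreal (e / 2) \<and> 1 \<le> n)
      sequentially"
    using eventually_ge_at_top by (rule eventually_conj)
  then obtain n where n: "(\<integral>\<^sup>+ y. g y * indicator {y. real n < r y} y \<partial>M) < ennreal (e / 2)" "1 \<le> n"
    using eventually_happens'[OF sequentially_bot] by blast
  have "(\<integral>y. kernel_density G q x y * indicator {y. real n < r y} y \<partial>M) \<le> e"
    if x: "x \<in> space M" for x
  proof -
    note Gx [measurable] = bspec[OF G x]
    \<comment> \<open>This inequality holds at every point: \<open>enn2real\<close> sends
      \<open>\<infinity>\<close> to 0 and so can only decrease the integrand.\<close>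
    have "(\<integral>\<^sup>+ y. ennreal (kernel_density G q x y * indicator {y. real n < r y} y) \<partial>M)
        \<le> (\<integral>\<^sup>+ y. (G x y * q y) * indicator {y. real n < r y} y \<partial>M)"
      by (rule nn_integral_mono)
        (auto simp: indicator_def kernel_density_def ennreal_enn2real_if)
    also have "\<dots> \<le> (\<integral>\<^sup>+ y \<in> {y \<in> space M. G x y * q y \<ge> g y}. G x y * q y \<partial>M)
        + (\<integral>\<^sup>+ y. g y * indicator {y. real n < r y} y \<partial>M)"
      by (rule nn_integral_split_le) (auto simp: indicator_def)
    also have "\<dots> \<le> ennreal (e / 2) + ennreal (e / 2)"
      by (intro add_mono bspec[OF ui x] less_imp_le[OF n(1)])
    also have "\<dots> = ennreal e"
      using \<open>0 < e\<close> by (simp flip: ennreal_plus)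
    finally show ?thesis
      using \<open>0 < e\<close> by (subst integral_eq_nn_integral) (auto intro!: enn2real_leI)
  qed
  with n(2) show ?thesis by blast
qed

section \<open>Transfer of compactness from a strictly positive \<open>p\<close> to
  \<open>q\<close>\<close>

text \<open>Linearity holds pointwise, for each fixed \<open>x\<close>. Measurability of
  \<open>K_op M G q f\<close> in \<open>x\<close> does not follow from the other hypotheses, so the
  mapping property enters as an assumption, to be supplied by approximation.\<close>

lemma linear_operator_K_op:
  assumes G: "\<forall>x\<in>space M. G x \<in> borel_measurable M" and q [measurable]: "q \<in> borel_measurable M"
    and fin: "\<forall>x\<in>space M. potential M G q x < \<infinity>"
    and maps: "\<And>f. f \<in> bounded_measurable M \<Longrightarrow> K_op M G q f \<in> bounded_measurable M"
  shows "linear_operator M (K_op M G q)"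
  unfolding linear_operator_def
proof (intro conjI ballI allI)
  show "K_op M G q \<in> bounded_measurable M \<rightarrow> bounded_measurable M" using maps by blast
next
  fix f g :: "'a \<Rightarrow> real" and a b x
  assume f: "f \<in> bounded_measurable M" and g: "g \<in> bounded_measurable M" and x: "x \<in> space M"
  note Gx [measurable] = bspec[OF G x] and finx = bspec[OF fin x]
  have [measurable]: "f \<in> borel_measurable M" "g \<in> borel_measurable M"
    using f g by (simp_all add: bounded_measurable_def)
  obtain c where c: "\<And>y. y \<in> space M \<Longrightarrow> \<bar>f y\<bar> \<le> c" using bounded_measurableE[OF f] by blast
  obtain d where d: "\<And>y. y \<in> space M \<Longrightarrow> \<bar>g y\<bar> \<le> d" using bounded_measurableE[OF g] by blast
  have fg: "(\<lambda>y\<in>space M. a * f y + b * g y) \<in> bounded_measurable M"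
  proof (rule restrict_bounded_measurable)
    fix y assume "y \<in> space M"
    then have "\<bar>a * f y\<bar> \<le> \<bar>a\<bar> * c" "\<bar>b * g y\<bar> \<le> \<bar>b\<bar> * d"
      using c d by (simp_all add: abs_mult mult_left_mono)
    then show "\<bar>a * f y + b * g y\<bar> \<le> \<bar>a\<bar> * c + \<bar>b\<bar> * d" by linarith
  qed simp
  have int: "integrable M (\<lambda>y. f y * kernel_density G q x y)"
    "integrable M (\<lambda>y. g y * kernel_density G q x y)"
    by (rule integrable_mult_kernel_density[OF Gx q _ finx c], simp_all,
        rule integrable_mult_kernel_density[OF Gx q _ finx d], simp_all)
  have "K_op M G q (\<lambda>y\<in>space M. a * f y + b * g y) x =
      (\<integral>y. (\<lambda>y\<in>space M. a * f y + b * g y) y * kernel_density G q x y \<partial>M)"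
    by (rule K_op_eq_integral[OF Gx q finx fg x])
  also have "\<dots> = (\<integral>y. a * (f y * kernel_density G q x y) + b * (g y * kernel_density G q x y) \<partial>M)"
    by (rule Bochner_Integration.integral_cong) (simp_all add: algebra_simps)
  also have "\<dots> = a * K_op M G q f x + b * K_op M G q g x"
    using int by (simp add: K_op_eq_integral[OF Gx q finx _ x] f g)
  finally show "K_op M G q (\<lambda>y\<in>space M. a * f y + b * g y) x = a * K_op M G q f x + b * K_op M G q g x" .
qed

text \<open>If \<open>p\<close> or \<open>q\<close> is infinite, finiteness of the products forces
  \<open>g = 0\<close>, and both sides vanish whatever value the quotient takes. Otherwise
  \<open>p\<close> is a positive real and cancels.\<close>

lemma enn2real_mult_change:
  fixes g p q :: ennreal
  assumes "g * q \<noteq> \<infinity>" "g * p \<noteq> \<infinity>" "0 < p"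
  shows "enn2real (g * q) = enn2real (q / p) * enn2real (g * p)"
proof (cases "g = 0 \<or> q = \<infinity> \<or> p = \<infinity>")
  case True
  moreover have "g = 0 \<or> q \<noteq> \<infinity>"
    using assms(1) unfolding infinity_ennreal_def ennreal_mult_eq_top_iff by blast
  moreover have "g = 0 \<or> p \<noteq> \<infinity>"
    using assms(2) unfolding infinity_ennreal_def ennreal_mult_eq_top_iff by blast
  ultimately have "g = 0" by blast
  then show ?thesis by simp
next
  case False
  then obtain a b where a: "q = ennreal a" "0 \<le> a" and b: "p = ennreal b" "0 \<le> b"
    by (metis ennreal_cases infinity_ennreal_def)
  have "0 < b" using assms(3) b by simp
  then have "q / p = ennreal (a / b)" using a b by (simp add: divide_ennreal)
  moreover have "enn2real q = a" "enn2real p = b" using a b by simp_all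
  ultimately show ?thesis
    using \<open>0 < b\<close> a(2) by (simp add: enn2real_mult)
qed

text \<open>Strict positivity makes \<open>p\<close> a reference function: the ratio of the two
  densities does not depend on \<open>x\<close>, only the exceptional null set does.\<close>

lemma AE_kernel_density_change:
  assumes Gx [measurable]: "G x \<in> borel_measurable M"
    and [measurable]: "q \<in> borel_measurable M" "p \<in> borel_measurable M"
    and fin: "potential M G q x < \<infinity>" "potential M G p x < \<infinity>" and pos: "strictly_positive M p"
  shows "AE y in M. kernel_density G q x y = enn2real (q y / p y) * kernel_density G p x y"
proof -
  have "AE y in M. G x y * q y \<noteq> \<infinity>"
    by (rule nn_integral_PInf_AE) (use fin(1) in \<open>simp_all add: potential_def\<close>)
  moreover have "AE y in M. G x y * p y \<noteq> \<infinity>"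
    by (rule nn_integral_PInf_AE) (use fin(2) in \<open>simp_all add: potential_def\<close>)
  ultimately show ?thesis
    using AE_space
  proof eventually_elim
    case (elim y)
    then have "0 < p y" using pos by (simp add: strictly_positive_def)
    with elim(1,2) show ?case
      unfolding kernel_density_def by (rule enn2real_mult_change)
  qed
qed

text \<open>On \<open>{r \<le> n}\<close> the outer factor \<open>n\<close> cancels the division,
  and \<open>r\<close> turns the density of \<open>p\<close> into that of \<open>q\<close>. What
  remains is the integral of \<open>f\<close> times the density of \<open>q\<close> over
  \<open>{n < r}\<close>, at most \<open>c\<close> times the tail. For nonnegative \<open>r\<close>,
  dividing by \<open>n\<close> keeps the multiplier between 0 and 1, so the argument of
  \<open>K_op M G p\<close> obeys the same bound as \<open>f\<close>.\<close>

lemma K_op_truncation: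
  fixes f r :: "'a \<Rightarrow> real" and n :: nat
  assumes Gx [measurable]: "G x \<in> borel_measurable M"
    and q [measurable]: "q \<in> borel_measurable M" and p [measurable]: "p \<in> borel_measurable M"
    and fin: "potential M G q x < \<infinity>" "potential M G p x < \<infinity>"
    and r [measurable]: "r \<in> borel_measurable M"
    and AE: "AE y in M. kernel_density G q x y = r y * kernel_density G p x y"
    and f: "f \<in> bounded_measurable M" and c: "\<And>y. y \<in> space M \<Longrightarrow> \<bar>f y\<bar> \<le> c" and x: "x \<in> space M"
    and n: "1 \<le> n" and h: "(\<lambda>y\<in>space M. f y * (r y * indicator {y. r y \<le> real n} y / real n)) \<in> bounded_measurable M"
    and tail: "(\<integral>y. kernel_density G q x y * indicator {y. real n < r y} y \<partial>M) \<le> e"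
  shows "\<bar>K_op M G q f x -
    real n * K_op M G p (\<lambda>y\<in>space M. f y * (r y * indicator {y. r y \<le> real n} y / real n)) x\<bar> \<le> c * e"
proof -
  let ?h = "\<lambda>y\<in>space M. f y * (r y * indicator {y. r y \<le> real n} y / real n)"
  let ?k = "kernel_density G q x"
  have [measurable]: "f \<in> borel_measurable M" using f by (simp add: bounded_measurable_def)
  have int: "integrable M (\<lambda>y. f y * ?k y)"
    by (rule integrable_mult_kernel_density[OF Gx q _ fin(1) c]) simp_all
  have int_le: "integrable M (\<lambda>y. (f y * ?k y) * indicator {y \<in> space M. r y \<le> real n} y)"
    by (rule integrable_real_mult_indicator[OF _ int]) measurable
  have "real n * K_op M G p ?h x = (\<integral>y. real n * (?h y * kernel_density G p x y) \<partial>M)"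
    unfolding K_op_eq_integral[OF Gx p fin(2) h x]
    by (rule integral_mult_right_zero[symmetric])
  also have "\<dots> = (\<integral>y. (f y * ?k y) * indicator {y \<in> space M. r y \<le> real n} y \<partial>M)"
  proof (rule integral_cong_AE)
    show "(\<lambda>y. real n * (?h y * kernel_density G p x y)) \<in> borel_measurable M"
      by (intro borel_measurable_times borel_measurable_const kernel_density_measurable Gx p
          h[unfolded mem_bounded_measurable_iff, THEN conjunct1])
    show "AE y in M. real n * (?h y * kernel_density G p x y) =
        (f y * ?k y) * indicator {y \<in> space M. r y \<le> real n} y"
      using AE AE_space by eventually_elim (use n in \<open>simp add: indicator_def\<close>)
  qed (use int_le in \<open>rule borel_measurable_integrable\<close>)
  finally have eq: "K_op M G q f x - real n * K_op M G p ?h x =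
      (\<integral>y. f y * ?k y - (f y * ?k y) * indicator {y \<in> space M. r y \<le> real n} y \<partial>M)"
    unfolding K_op_eq_integral[OF Gx q fin(1) f x]
    by (simp only: Bochner_Integration.integral_diff[OF int int_le])
  have "\<bar>K_op M G q f x - real n * K_op M G p ?h x\<bar>
      \<le> (\<integral>y. \<bar>f y * ?k y - (f y * ?k y) * indicator {y \<in> space M. r y \<le> real n} y\<bar> \<partial>M)"
    unfolding eq by (rule integral_abs_bound)
  also have "\<dots> \<le> (\<integral>y. c * (?k y * indicator {y. real n < r y} y) \<partial>M)"
  proof (rule integral_mono)
    have "integrable M (\<lambda>y. ?k y * indicator {y. real n < r y} y)"
      by (rule Bochner_Integration.integrable_bound[OF integrable_kernel_density[OF Gx q fin(1)]])
        (simp_all add: indicator_def)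
    then show "integrable M (\<lambda>y. c * (?k y * indicator {y. real n < r y} y))" by simp
    show "\<bar>f y * ?k y - (f y * ?k y) * indicator {y \<in> space M. r y \<le> real n} y\<bar>
        \<le> c * (?k y * indicator {y. real n < r y} y)" if "y \<in> space M" for y
    proof (cases "r y \<le> real n")
      case False
      have "\<bar>f y\<bar> * ?k y \<le> c * ?k y" using c[OF that] by (rule mult_right_mono) simp
      with False show ?thesis by (simp add: abs_mult)
    qed (use that in simp)
  qed (rule integrable_abs[OF Bochner_Integration.integrable_diff[OF int int_le]])
  also have "\<dots> = c * (\<integral>y. ?k y * indicator {y. real n < r y} y \<partial>M)" by simp
  \<comment> \<open>The constant \<open>c\<close> is nonnegative because it bounds an absolute value
    at the point \<open>x\<close>.\<close>
  also have "\<dots> \<le> c * e"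
    by (rule mult_left_mono[OF tail order_trans[OF abs_ge_zero c[OF x]]])
  finally show ?thesis .
qed

text \<open>The estimate \<open>approx\<close> is used twice: with the bound \<open>c\<close> of a
  single function, to see that \<open>K_op M G q\<close> maps into the space, and with
  \<open>c = 1\<close> on the unit ball, to carry nets over from \<open>K_op M G p\<close>.\<close>

lemma F_ui_subset_F_co:
  assumes G: "\<forall>x\<in>space M. G x \<in> borel_measurable M"
    and p_co: "p \<in> F_co M G" and pos: "strictly_positive M p"
  shows "F_ui M G \<subseteq> F_co M G"
proof
  fix q assume q: "q \<in> F_ui M G"
  have p [measurable]: "p \<in> borel_measurable M" and co: "compact_operator M (K_op M G p)"
    and fin_p: "\<forall>x\<in>space M. potential M G p x < \<infinity>"
    using p_co by (auto simp: F_co_def bounded_potential_def intro: le_less_trans)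
  have qm [measurable]: "q \<in> borel_measurable M" using q by (simp add: F_ui_def)
  have bdd: "bounded_potential M G q" by (rule F_ui_bounded_potential[OF G q])
  then have fin_q: "\<forall>x\<in>space M. potential M G q x < \<infinity>"
    by (auto simp: bounded_potential_def intro: le_less_trans)
  have maps_p: "K_op M G p f \<in> bounded_measurable M" if "f \<in> bounded_measurable M" for f
    using co that by (auto simp: compact_operator_def linear_operator_def)

  \<comment> \<open>Where \<open>q y / p y\<close> is infinite, \<open>r y\<close> is 0. This is
    harmless: \<open>q y\<close> is infinite there, and the finite potential of \<open>q\<close> at
    \<open>x\<close> forces \<open>G x y = 0\<close> for almost all such \<open>y\<close>.\<close>
  define r where "r y = enn2real (q y / p y)" for y
  have r [measurable]: "r \<in> borel_measurable M" unfolding r_def[abs_def] by measurable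
  define h where "h n f = (\<lambda>y\<in>space M. f y * (r y * indicator {y. r y \<le> real n} y / real n))"
    for n :: nat and f
  have h_le: "\<bar>h n f y\<bar> \<le> c" if "1 \<le> n" "\<bar>f y\<bar> \<le> c" "y \<in> space M" for n f y c
  proof -
    have "\<bar>r y * indicator {y. r y \<le> real n} y / real n\<bar> \<le> 1"
      using that(1) by (auto simp: indicator_def r_def)
    then have "\<bar>f y\<bar> * \<bar>r y * indicator {y. r y \<le> real n} y / real n\<bar> \<le> c * 1"
      using that(2) by (intro mult_mono) auto
    then show ?thesis using that(3) by (simp add: h_def abs_mult)
  qed
  have h_bm: "h n f \<in> bounded_measurable M" if n: "1 \<le> n" and f: "f \<in> bounded_measurable M" for n f
  proof -
    have [measurable]: "f \<in> borel_measurable M" using f by (simp add: bounded_measurable_def)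
    obtain c where c: "\<And>y. y \<in> space M \<Longrightarrow> \<bar>f y\<bar> \<le> c" using bounded_measurableE[OF f] by blast
    show ?thesis unfolding h_def
    proof (rule restrict_bounded_measurable)
      show "\<bar>f y * (r y * indicator {y. r y \<le> real n} y / real n)\<bar> \<le> c" if "y \<in> space M" for y
        using h_le[of n f y c, OF n c[OF that] that] that by (simp add: h_def)
    qed measurable
  qed
  \<comment> \<open>\<open>n * K_op M G p (h n f)\<close> is \<open>K\<close> for the potential \<open>q\<close> cut off to \<open>{q \<le> n p}\<close>\<close>
  have approx: "\<exists>n\<ge>1. \<forall>f\<in>bounded_measurable M. (\<forall>y\<in>space M. \<bar>f y\<bar> \<le> c) \<longrightarrow>
      (\<forall>x\<in>space M. \<bar>K_op M G q f x - real n * K_op M G p (h n f) x\<bar> \<le> e)"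
    if "0 < c" "0 < e" for c e :: real
  proof -
    have "0 < e / c" using that by simp
    from F_ui_tail[OF G q r this] obtain n where n: "1 \<le> n" and tail: "\<forall>x\<in>space M.
        (\<integral>y. kernel_density G q x y * indicator {y. real n < r y} y \<partial>M) \<le> e / c"
      by (elim exE conjE)
    have "\<bar>K_op M G q f x - real n * K_op M G p (h n f) x\<bar> \<le> e"
      if f: "f \<in> bounded_measurable M" and fc: "\<forall>y\<in>space M. \<bar>f y\<bar> \<le> c" and x: "x \<in> space M" for f x
    proof -
      note Gx = bspec[OF G x] and finx = bspec[OF fin_q x] bspec[OF fin_p x]
      have AE: "AE y in M. kernel_density G q x y = r y * kernel_density G p x y"
        unfolding r_def by (rule AE_kernel_density_change[OF Gx qm p finx pos])
      have "\<bar>K_op M G q f x - real n * K_op M G p (h n f) x\<bar> \<le> c * (e / c)"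
        unfolding h_def
        by (rule K_op_truncation[OF Gx qm p finx r AE f bspec[OF fc] x n h_bm[OF n f, unfolded h_def]
              bspec[OF tail x]])
      then show ?thesis using \<open>0 < c\<close> by simp
    qed
    with n show ?thesis by blast
  qed

  \<comment> \<open>Measurability is inherited from the truncated operators: they map into the
    space, and their values at \<open>f\<close> converge uniformly to \<open>K_op M G q f\<close>.
    The approximant \<open>u 0\<close>, at distance at most 1, gives boundedness.\<close>
  have maps_q: "K_op M G q f \<in> bounded_measurable M" if f: "f \<in> bounded_measurable M" for f
  proof -
    obtain c where "0 < c" and fc: "\<And>y. y \<in> space M \<Longrightarrow> \<bar>f y\<bar> \<le> c"
      using bounded_measurableE[OF f] by blast
    have "\<exists>u\<in>bounded_measurable M. \<forall>x\<in>space M. \<bar>K_op M G q f x - u x\<bar> \<le> 1 / Suc m" for m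
    proof -
      have "0 < 1 / real (Suc m)" by simp
      from approx[OF \<open>0 < c\<close> this] obtain n where n: "1 \<le> n"
        "\<forall>f\<in>bounded_measurable M. (\<forall>y\<in>space M. \<bar>f y\<bar> \<le> c) \<longrightarrow>
          (\<forall>x\<in>space M. \<bar>K_op M G q f x - real n * K_op M G p (h n f) x\<bar> \<le> 1 / Suc m)"
        by (elim exE conjE)
      let ?u = "\<lambda>x\<in>space M. real n * K_op M G p (h n f) x"
      have v: "K_op M G p (h n f) \<in> bounded_measurable M"
        by (rule maps_p[OF h_bm[OF n(1) f]])
      then have [measurable]: "K_op M G p (h n f) \<in> borel_measurable M"
        by (simp add: bounded_measurable_def)
      obtain d where d: "\<And>x. x \<in> space M \<Longrightarrow> \<bar>K_op M G p (h n f) x\<bar> \<le> d"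
        using bounded_measurableE[OF v] by blast
      have "?u \<in> bounded_measurable M"
        by (rule restrict_bounded_measurable[where c = "real n * d"])
          (simp_all add: abs_mult d mult_left_mono)
      moreover have "\<forall>x\<in>space M. \<bar>K_op M G q f x - ?u x\<bar> \<le> 1 / Suc m"
        using bspec[OF n(2) f] fc by simp
      ultimately show ?thesis by (intro bexI[of _ ?u])
    qed
    then obtain u where u: "\<And>m. u m \<in> bounded_measurable M"
      and close: "\<And>m x. x \<in> space M \<Longrightarrow> \<bar>K_op M G q f x - u m x\<bar> \<le> 1 / Suc m"
      by metis
    have "(\<lambda>m. u m x) \<longlonglongrightarrow> K_op M G q f x" if x: "x \<in> space M" for x
    proof (rule LIMSEQ_I)
      fix e :: real assume "0 < e"
      then obtain N where N: "1 / real (Suc N) < e" using nat_approx_posE by blast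
      have "norm (u m x - K_op M G q f x) < e" if "N \<le> m" for m
      proof -
        have "1 / real (Suc m) \<le> 1 / real (Suc N)" using that by (simp add: frac_le)
        with N close[OF x, of m] show ?thesis by (simp add: abs_minus_commute)
      qed
      then show "\<exists>N. \<forall>m\<ge>N. norm (u m x - K_op M G q f x) < e" by blast
    qed
    moreover have "u m \<in> borel_measurable M" for m
      using u[of m] by (simp add: bounded_measurable_def)
    ultimately have meas: "K_op M G q f \<in> borel_measurable M"
      by (rule borel_measurable_LIMSEQ_real)
    obtain d where d: "\<And>x. x \<in> space M \<Longrightarrow> \<bar>u 0 x\<bar> \<le> d"
      using bounded_measurableE[OF u[of 0]] by blast
    have "restrict (K_op M G q f) (space M) \<in> bounded_measurable M"
    proof (rule restrict_bounded_measurable)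
      show "\<bar>K_op M G q f x\<bar> \<le> d + 1" if "x \<in> space M" for x
      proof -
        have "\<bar>K_op M G q f x - u 0 x\<bar> \<le> 1" using close[OF that, of 0] by simp
        with d[OF that] show ?thesis by linarith
      qed
    qed (rule meas)
    moreover have "restrict (K_op M G q f) (space M) = K_op M G q f"
      by (simp add: K_op_def)
    ultimately show ?thesis by simp
  qed

  have "compact_operator M (K_op M G q)"
    unfolding compact_operator_iff
  proof (intro conjI allI impI)
    show "linear_operator M (K_op M G q)"
      by (rule linear_operator_K_op[OF G qm fin_q maps_q])
    fix e :: real assume "0 < e"
    then have "0 < e / 2" by simp
    from approx[OF zero_less_one this] obtain n where n: "1 \<le> n"
      and app: "\<forall>f\<in>bounded_measurable M. (\<forall>y\<in>space M. \<bar>f y\<bar> \<le> 1) \<longrightarrow>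
        (\<forall>x\<in>space M. \<bar>K_op M G q f x - real n * K_op M G p (h n f) x\<bar> \<le> e / 2)"
      by (elim exE conjE)
    \<comment> \<open>Multiplying the net of \<open>K_op M G p\<close> by \<open>n\<close> magnifies
      its error to \<open>e / 2\<close>; the other half of \<open>e\<close> pays for the
      truncation.\<close>
    have "0 < e / (2 * real n)" using \<open>0 < e\<close> n by simp
    from co[unfolded compact_operator_iff, THEN conjunct2, THEN spec, THEN mp, OF this]
    obtain K where K: "finite K" "K \<subseteq> bounded_measurable M"
      and net: "\<forall>f\<in>bounded_measurable M. (\<forall>x\<in>space M. \<bar>f x\<bar> \<le> 1) \<longrightarrow>
        (\<exists>k\<in>K. \<forall>x\<in>space M. \<bar>K_op M G p f x - k x\<bar> \<le> e / (2 * real n))"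
      by (elim exE conjE)
    define s where "s k = (\<lambda>x\<in>space M. real n * k x)" for k :: "'a \<Rightarrow> real"
    have "s k \<in> bounded_measurable M" if "k \<in> K" for k
    proof -
      have k: "k \<in> bounded_measurable M" using K(2) that by blast
      then have [measurable]: "k \<in> borel_measurable M" by (simp add: bounded_measurable_def)
      obtain d where "\<And>x. x \<in> space M \<Longrightarrow> \<bar>k x\<bar> \<le> d" using bounded_measurableE[OF k] by blast
      then show ?thesis unfolding s_def
        by (intro restrict_bounded_measurable[where c = "real n * d"])
          (simp_all add: abs_mult mult_left_mono)
    qed
    moreover have "\<exists>k\<in>s ` K. \<forall>x\<in>space M. \<bar>K_op M G q f x - k x\<bar> \<le> e"
      if f: "f \<in> bounded_measurable M" and f1: "\<forall>x\<in>space M. \<bar>f x\<bar> \<le> 1" for f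
    proof -
      have "\<forall>x\<in>space M. \<bar>h n f x\<bar> \<le> 1" using h_le[OF n] f1 by blast
      from bspec[OF net h_bm[OF n f], THEN mp, OF this]
      obtain k where k: "k \<in> K"
        and close: "\<forall>x\<in>space M. \<bar>K_op M G p (h n f) x - k x\<bar> \<le> e / (2 * real n)"
        by (elim bexE)
      have "\<bar>K_op M G q f x - s k x\<bar> \<le> e" if x: "x \<in> space M" for x
      proof -
        have "real n * \<bar>K_op M G p (h n f) x - k x\<bar> \<le> real n * (e / (2 * real n))"
          by (rule mult_left_mono[OF bspec[OF close x]]) simp
        also have "real n * (e / (2 * real n)) = e / 2" using n by simp
        also have "real n * \<bar>K_op M G p (h n f) x - k x\<bar> = \<bar>real n * K_op M G p (h n f) x - s k x\<bar>"
          using x by (simp add: s_def abs_mult flip: right_diff_distrib)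
        finally have "\<bar>real n * K_op M G p (h n f) x - s k x\<bar> \<le> e / 2" .
        moreover have "\<bar>K_op M G q f x - real n * K_op M G p (h n f) x\<bar> \<le> e / 2"
          by (rule bspec[OF bspec[OF app f, THEN mp, OF f1] x])
        ultimately show ?thesis by linarith
      qed
      with k show ?thesis by (intro bexI[of _ "s k"]) auto
    qed
    ultimately show "\<exists>K. finite K \<and> K \<subseteq> bounded_measurable M \<and>
        (\<forall>f\<in>bounded_measurable M. (\<forall>x\<in>space M. \<bar>f x\<bar> \<le> 1) \<longrightarrow>
          (\<exists>k\<in>K. \<forall>x\<in>space M. \<bar>K_op M G q f x - k x\<bar> \<le> e))"
      using K(1) by (intro exI[of _ "s ` K"] conjI ballI impI) auto
  qed
  with bdd show "q \<in> F_co M G" by (simp add: F_co_def)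
qed

theorem corollary2p3:
  fixes M :: "'a measure" and G :: "'a \<Rightarrow> 'a \<Rightarrow> ennreal"
  assumes "(\<lambda>(x, y). G x y) \<in> borel_measurable (M \<Otimes>\<^sub>M M)"
    and "\<exists>q \<in> F_ui M G. strictly_positive M q"
    and "\<exists>q \<in> F_co M G. strictly_positive M q"
  shows "F_co M G = F_ui M G"
proof -
  have G: "\<forall>x\<in>space M. G x \<in> borel_measurable M"
    using measurable_Pair2[OF assms(1)] by simp
  obtain p where "p \<in> F_co M G" "strictly_positive M p" using assms(3) by (elim bexE)
  then show ?thesis
    using F_co_subset_F_ui[OF G] F_ui_subset_F_co[OF G] by (intro equalityI)
qed

end
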